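(* Let $\alpha', \beta'$ be odd integers and $\gamma$ an integer, and let $q(n) = \frac{\alpha'}{2} n^2 + \frac{\beta'}{2} n + \gamma$ for $n \geq 0$ (an integer for every integer $n$). Then $D_q(n) = 2^{\lceil \log_2 n \rceil}$ for all integers $n \geq 1$ if and only if $\alpha' = \beta'$.
   Context: For an integer sequence $s = (s(i))_{i \geq 0}$ and an integer $n \geq 1$, the discriminator $D_s(n)$ is the least positive integer $m$ such that $s(0), \ldots, s(n-1)$ are pairwise incongruent modulo $m$. If two of $s(0), \ldots, s(n-1)$ are equal, no such $m$ exists, and then $D_s(n) \neq 2^{\lceil \log_2 n \rceil}$ is understood to hold. *)

theory Defs
  imports Complex_Main "HOL-Number_Theory.Cong"
begin

definition discriminates :: "(nat \<Rightarrow> int) \<Rightarrow> nat \<Rightarrow> nat \<Rightarrow> bool" where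
  "discriminates s n m \<longleftrightarrow>
     m > 0 \<and> (\<forall>i<n. \<forall>j<n. i \<noteq> j \<longrightarrow> \<not> [s i = s j] (mod int m))"

text \<open>The value \<open>None\<close> occurs exactly when two of \<open>s 0, \<dots>, s (n - 1)\<close> are equal, so that an
  equation \<open>discriminator s n = Some m\<close> is false in that case.\<close>

definition discriminator :: "(nat \<Rightarrow> int) \<Rightarrow> nat \<Rightarrow> nat option" where
  "discriminator s n =
     (if \<exists>m. discriminates s n m then Some (LEAST m. discriminates s n m) else None)"

lemma half_quadratic_in_Ints:
  fixes \<alpha>' \<beta>' \<gamma> n :: int
  assumes "odd \<alpha>'" and "odd \<beta>'"
  shows "of_int \<alpha>' / 2 * of_int n ^ 2 + of_int \<beta>' / 2 * of_int n + of_int \<gamma> \<in> (\<int> :: real set)"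
proof -
  have "even (\<alpha>' * n ^ 2 + \<beta>' * n)"
    using assms by simp
  then obtain k where "\<alpha>' * n ^ 2 + \<beta>' * n = 2 * k" ..
  then have "of_int \<alpha>' * of_int n ^ 2 + of_int \<beta>' * of_int n = 2 * (of_int k :: real)"
    by (metis of_int_add of_int_mult of_int_numeral of_int_power)
  then have "of_int \<alpha>' / 2 * of_int n ^ 2 + of_int \<beta>' / 2 * of_int n + of_int \<gamma>
      = (of_int (k + \<gamma>) :: real)"
    by (simp add: field_simps)
  then show ?thesis
    by (metis Ints_of_int)
qed

end

theory Submission
  imports Defs "HOL-Library.Log_Nat" "HOL-Library.Nat_Bijection"
begin

text \<open>
  The differences of \<open>q\<close> are \<open>q (n + 1) - q n = a n + b\<close> with \<open>a = \<alpha>'\<close> odd and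
  \<open>b = (\<alpha>' + \<beta>') / 2\<close>, so that \<open>\<alpha>' = \<beta>'\<close> means \<open>a = b\<close>.

  If \<open>a = b\<close>, then \<open>q\<close> is an affine image \<open>a T + q 0\<close> of the sequence \<open>T\<close> of triangular numbers.
  The two factors of \<open>2 (T j - T i) = (j - i) (i + j + 1)\<close> have opposite parity, so a power of two
  dividing the product divides one of them, and no two of the first \<open>2 ^ k\<close> triangular numbers
  agree modulo \<open>2 ^ k\<close>. On the other hand, \<open>m = 2 ^ e (2 t + 1)\<close> is a sum of consecutive positive
  integers ending in \<open>2 ^ e + t\<close>, hence a difference \<open>T j - T i\<close> with \<open>j = 2 ^ e + t\<close>, and \<open>j < n\<close> if
  \<open>m < 2 ^ k < 2 n\<close>.

  Conversely, for a modulus \<open>m\<close> coprime to \<open>a\<close>, exactly one of the differences at \<open>0, \<dots>, m - 1\<close> is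
  divisible by \<open>m\<close>. If \<open>q 0, \<dots>, q (m - 1)\<close> are pairwise incongruent, it must be the last one, which
  is congruent to \<open>b - a\<close>. Taking \<open>m = 2 ^ k\<close> for all \<open>k\<close> gives \<open>a = b\<close>.
\<close>

lemma discriminates_pos: "discriminates s n m \<Longrightarrow> m > 0"
  by (simp add: discriminates_def)

lemma discriminates_congD:
  assumes "discriminates s n m" and "i < n" and "j < n" and "[s i = s j] (mod int m)"
  shows "i = j"
  using assms unfolding discriminates_def by blast

lemma discriminatesI_less:
  assumes "m > 0" and "\<And>i j. i < j \<Longrightarrow> j < n \<Longrightarrow> \<not> [s i = s j] (mod int m)"
  shows "discriminates s n m"
  unfolding discriminates_def using assms by (metis cong_sym linorder_neqE_nat)

lemma discriminates_affineD:
  "discriminates (\<lambda>i. a * s i + c) n m \<Longrightarrow> discriminates s n m"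
  unfolding discriminates_def by (blast intro: cong_add cong_scalar_left cong_refl)

lemma discriminates_affine_iff:
  assumes "coprime a (int m)"
  shows "discriminates (\<lambda>i. a * s i + c) n m \<longleftrightarrow> discriminates s n m"
  using assms by (simp add: discriminates_def cong_add_rcancel cong_mult_lcancel)

lemma discriminator_eq_SomeD: "discriminator s n = Some m \<Longrightarrow> discriminates s n m"
  unfolding discriminator_def by (auto intro: LeastI split: if_splits)

lemma discriminator_eq_SomeI:
  assumes "discriminates s n m" and "\<And>l. discriminates s n l \<Longrightarrow> m \<le> l"
  shows "discriminator s n = Some m"
  using assms unfolding discriminator_def by (auto intro: Least_equality)

lemma prime_power_dvd_mult_cases:
  fixes p x y :: "'a :: factorial_semiring"
  assumes "prime_elem p" and "p ^ k dvd x * y" and "\<not> (p dvd x \<and> p dvd y)"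
  shows "p ^ k dvd x \<or> p ^ k dvd y"
proof (cases "k = 0")
  case False
  have "p ^ k dvd y * x"
    using assms(2) by (simp only: mult.commute)
  then show ?thesis
    using assms False by (meson neq0_conv prime_power_dvd_multD)
qed simp

lemma double_triangle: "2 * triangle n = n * Suc n"
  by (simp add: triangle_def)

lemma double_triangle_diff:
  "2 * (int (triangle j) - int (triangle i)) = (int j - int i) * (int i + int j + 1)"
proof -
  have "2 * int (triangle n) = int n * (int n + 1)" for n
    using arg_cong[OF double_triangle, of int n] by (simp add: algebra_simps)
  then show ?thesis
    by (simp add: algebra_simps)
qed

lemma discriminates_triangle_two_power:
  assumes "n \<le> 2 ^ k"
  shows "discriminates (\<lambda>i. int (triangle i)) n (2 ^ k)"
proof (rule discriminatesI_less)
  fix i j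
  assume "i < j" and "j < n"
  show "\<not> [int (triangle i) = int (triangle j)] (mod int (2 ^ k))"
  proof
    assume "[int (triangle i) = int (triangle j)] (mod int (2 ^ k))"
    then have "2 ^ k dvd int (triangle j) - int (triangle i)"
      by (simp add: cong_iff_dvd_diff dvd_diff_commute)
    then have "2 ^ Suc k dvd 2 * (int (triangle j) - int (triangle i))"
      unfolding power_Suc by (rule mult_dvd_mono[OF dvd_refl])
    then have "2 ^ Suc k dvd (int j - int i) * (int i + int j + 1)"
      by (simp only: double_triangle_diff)
    moreover have "\<not> (even (int j - int i) \<and> even (int i + int j + 1))"
      by presburger
    ultimately have "2 ^ Suc k dvd int j - int i \<or> 2 ^ Suc k dvd int i + int j + 1"
      by (rule prime_power_dvd_mult_cases[rotated]) simp
    moreover have "int n \<le> 2 ^ k"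
      using assms by (metis of_nat_le_iff of_nat_numeral of_nat_power)
    then have "int j - int i < 2 ^ Suc k" and "int i + int j + 1 < 2 ^ Suc k"
      using \<open>i < j\<close> \<open>j < n\<close> unfolding power_Suc by linarith+
    ultimately show False
      using \<open>i < j\<close> zdvd_not_zless[of "int j - int i" "2 ^ Suc k"]
        zdvd_not_zless[of "int i + int j + 1" "2 ^ Suc k"] by linarith
  qed
qed simp

lemma triangle_add_eq_triangle_plus_mult_odd:
  assumes "w > 0"
  shows "\<exists>i < w + t. triangle (w + t) = triangle i + w * (2 * t + 1)"
proof -
  obtain i where "t = w + i \<or> w = Suc (t + i)"
    using le_Suc_ex[of w t] less_imp_Suc_add[of t w] by (cases "w \<le> t") auto
  then have "2 * triangle (w + t) = 2 * (triangle i + w * (2 * t + 1))" and "i < w + t"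
    unfolding distrib_left double_triangle using assms by (auto simp: algebra_simps)
  then show ?thesis
    by auto
qed

lemma double_two_power_add_le:
  fixes e k t :: nat
  assumes "2 ^ e * (2 * t + 1) < 2 ^ k"
  shows "2 * (2 ^ e + t) \<le> 2 ^ k"
proof (cases t)
  case 0
  with assms have "Suc e \<le> k"
    by simp
  then have "(2::nat) ^ Suc e \<le> 2 ^ k"
    by (intro power_increasing) simp_all
  with 0 show ?thesis
    by simp
next
  case (Suc t')
  obtain w' :: nat where "2 ^ e = Suc w'"
    using not0_implies_Suc[of "2 ^ e"] by auto
  with Suc have "2 * (2 ^ e + t) \<le> 2 ^ e * (2 * t + 1) + 1"
    by (simp add: algebra_simps)
  with assms show ?thesis
    by linarith
qed

lemma discriminates_triangle_imp_two_power_le: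
  assumes "discriminates (\<lambda>i. int (triangle i)) n m" and "2 ^ k < 2 * n"
  shows "2 ^ k \<le> m"
proof (rule ccontr)
  assume "\<not> 2 ^ k \<le> m"
  have "m \<noteq> 0"
    using discriminates_pos[OF assms(1)] by simp
  define e where "e = multiplicity 2 m"
  obtain y where "m = 2 ^ e * y" and "odd y"
    unfolding e_def using \<open>m \<noteq> 0\<close> by (rule multiplicity_decompose'[of m 2]) simp_all
  then obtain t where m_eq: "m = 2 ^ e * (2 * t + 1)"
    by (blast elim: oddE)
  obtain i where "i < 2 ^ e + t" and triangle_eq: "triangle (2 ^ e + t) = triangle i + m"
    using triangle_add_eq_triangle_plus_mult_odd[of "2 ^ e" t] m_eq by auto
  have "2 ^ e + t < n"
    using double_two_power_add_le[of e t k] m_eq \<open>\<not> 2 ^ k \<le> m\<close> assms(2) by simp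
  moreover have "[int (triangle i) = int (triangle (2 ^ e + t))] (mod int m)"
    by (simp add: triangle_eq cong_def)
  ultimately show False
    using discriminates_congD[OF assms(1), of i "2 ^ e + t"] \<open>i < 2 ^ e + t\<close> by simp
qed

lemma discriminator_odd_mult_triangle:
  assumes "odd a" and "n > 0"
  shows "discriminator (\<lambda>i. a * int (triangle i) + c) n = Some (2 ^ ceillog2 n)"
proof (rule discriminator_eq_SomeI)
  have "coprime a (int (2 ^ ceillog2 n))"
    using assms(1) by simp
  then show "discriminates (\<lambda>i. a * int (triangle i) + c) n (2 ^ ceillog2 n)"
    using discriminates_triangle_two_power[OF le_two_power_ceillog2]
    by (simp only: discriminates_affine_iff)
next
  fix l
  assume "discriminates (\<lambda>i. a * int (triangle i) + c) n l"
  then show "2 ^ ceillog2 n \<le> l"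
    using two_power_ceillog2_gt[OF assms(2)]
    by (intro discriminates_triangle_imp_two_power_le) (rule discriminates_affineD)
qed

lemma affine_diff_eq_triangle:
  fixes s :: "nat \<Rightarrow> 'a :: comm_ring_1"
  assumes "\<And>n. s (Suc n) = s n + a * of_nat n + b"
  shows "s n = a * of_nat (triangle n) + (b - a) * of_nat n + s 0"
  by (induction n) (simp_all add: assms algebra_simps)

lemma cong_if_discriminates_affine_diff:
  fixes s :: "nat \<Rightarrow> int"
  assumes diff: "\<And>n. s (Suc n) = s n + a * int n + b"
    and "coprime a (int m)" and discr: "discriminates s m m"
  shows "[a = b] (mod int m)"
proof -
  obtain x where "[a * x = - b] (mod int m)"
    using assms(2) cong_solve_dvd_int[of a "int m" "- b"] by (auto simp: coprime_iff_gcd_eq_1)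
  define i where "i = nat (x mod int m)"
  have "m > 0"
    using discr by (rule discriminates_pos)
  then have int_i: "int i = x mod int m" and "i < m"
    by (simp_all add: i_def nat_less_iff)
  have "[a * int i = a * x] (mod int m)"
    by (simp add: int_i cong_def mod_mult_right_eq)
  also note \<open>[a * x = - b] (mod int m)\<close>
  finally have diff_dvd: "int m dvd a * int i + b"
    by (simp add: cong_iff_dvd_diff)
  then have "[s (Suc i) = s i] (mod int m)"
    by (simp add: diff cong_iff_dvd_diff add.assoc)
  then have "\<not> Suc i < m"
    using discriminates_congD[OF discr, of "Suc i" i] \<open>i < m\<close> by auto
  with \<open>i < m\<close> have "m = Suc i"
    by simp
  then have "a * int m - (a * int i + b) = a - b"
    by (simp add: algebra_simps)
  with diff_dvd show ?thesis
    unfolding cong_iff_dvd_diff by (metis dvd_diff dvd_triv_right)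
qed

lemma int_eq_if_cong_all_powers:
  fixes a b p :: int
  assumes "p > 1" and "\<And>k. [a = b] (mod p ^ k)"
  shows "a = b"
proof (rule ccontr)
  assume "a \<noteq> b"
  have "p ^ nat \<bar>a - b\<bar> dvd a - b"
    using assms(2) by (simp add: cong_iff_dvd_diff)
  then have "\<bar>p ^ nat \<bar>a - b\<bar>\<bar> \<le> \<bar>a - b\<bar>"
    using \<open>a \<noteq> b\<close> by (intro dvd_imp_le_int) simp_all
  moreover have "nat \<bar>a - b\<bar> < nat p ^ nat \<bar>a - b\<bar>"
    using assms(1) by (intro power_gt_expt) simp
  then have "\<bar>a - b\<bar> < p ^ nat \<bar>a - b\<bar>"
    using assms(1) by (simp add: nat_less_iff flip: nat_power_eq)
  ultimately show False
    by simp
qed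

lemma discriminator_affine_diff_eq_two_power_iff:
  fixes s :: "nat \<Rightarrow> int"
  assumes "odd a" and diff: "\<And>n. s (Suc n) = s n + a * int n + b"
  shows "(\<forall>n>0. discriminator s n = Some (2 ^ ceillog2 n)) \<longleftrightarrow> a = b"
proof
  assume discr: "\<forall>n>0. discriminator s n = Some (2 ^ ceillog2 n)"
  have "[a = b] (mod 2 ^ k)" for k
  proof -
    have "discriminator s (2 ^ k) = Some (2 ^ k)"
      using discr by simp
    then have "discriminates s (2 ^ k) (2 ^ k)"
      by (rule discriminator_eq_SomeD)
    moreover have "coprime a (int (2 ^ k))"
      using assms(1) by simp
    ultimately have "[a = b] (mod int (2 ^ k))"
      using diff by (intro cong_if_discriminates_affine_diff)
    then show ?thesis
      by simp
  qed
  then show "a = b"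
    by (intro int_eq_if_cong_all_powers[of 2]) simp_all
next
  assume "a = b"
  then have "s n = a * int (triangle n) + s 0" for n
    using affine_diff_eq_triangle[OF diff, of n] by simp
  then have s_eq: "s = (\<lambda>n. a * int (triangle n) + s 0)" ..
  show "\<forall>n>0. discriminator s n = Some (2 ^ ceillog2 n)"
    using assms(1) by (subst s_eq) (simp add: discriminator_odd_mult_triangle)
qed

theorem theorem11:
  fixes \<alpha>' \<beta>' \<gamma> :: int and q :: "nat \<Rightarrow> int"
  assumes "odd \<alpha>'" and "odd \<beta>'"
    and "\<And>n. real_of_int (q n)
           = real_of_int \<alpha>' / 2 * real n ^ 2 + real_of_int \<beta>' / 2 * real n + real_of_int \<gamma>"
  shows "(\<forall>n\<ge>1. discriminator q n = Some (2 ^ nat \<lceil>log 2 (real n)\<rceil>)) \<longleftrightarrow> \<alpha>' = \<beta>'"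
proof -
  obtain b where double_b: "\<alpha>' + \<beta>' = 2 * b"
    using assms(1,2) by (meson evenE odd_even_add)
  have "q (Suc n) = q n + \<alpha>' * int n + b" for n
  proof -
    have "2 * real_of_int b = real_of_int \<alpha>' + real_of_int \<beta>'"
      using arg_cong[OF double_b, of real_of_int] by simp
    then have "real_of_int (q (Suc n)) = real_of_int (q n + \<alpha>' * int n + b)"
      by (simp add: assms(3) field_simps power2_eq_square)
    then show ?thesis
      by (simp only: of_int_eq_iff)
  qed
  then have "(\<forall>n>0. discriminator q n = Some (2 ^ ceillog2 n)) \<longleftrightarrow> \<alpha>' = b"
    by (rule discriminator_affine_diff_eq_two_power_iff[OF assms(1)])
  moreover have "\<alpha>' = b \<longleftrightarrow> \<alpha>' = \<beta>'"
    using double_b by linarith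
  ultimately show ?thesis
    by (simp add: ceillog2_def Suc_le_eq)
qed

end
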